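(* Let $n\ge1$. If $y\in\mathcal{M}_{n,2}$ and the moment matrix $M_1(y)$ is positive semidefinite, then $y$ has a $\operatorname{rank} M_1(y)$-atomic representing measure.
   Context: $\mathbb{Z}_+$ is the set of nonnegative integers, and for $\alpha=(\alpha_1,\ldots,\alpha_n)\in\mathbb{Z}_+^n$ and $x=(x_1,\ldots,x_n)\in\mathbb{R}^n$ we write $|\alpha|=\alpha_1+\cdots+\alpha_n$ and $x^\alpha=x_1^{\alpha_1}\cdots x_n^{\alpha_n}$. $\mathcal{M}_{n,2}$ is the set of all real multisequences $y=(y_\alpha)_{\alpha\in\mathbb{Z}_+^n,\,|\alpha|\le2}$. $M_1(y)$ is the $(n+1)\times(n+1)$ real symmetric matrix with rows and columns indexed by $\alpha,\beta\in\mathbb{Z}_+^n$ with $|\alpha|,|\beta|\le1$, and with $(\alpha,\beta)$ entry $y_{\alpha+\beta}$. A representing measure for $y$ is a positive Borel measure $\mu$ on $\mathbb{R}^n$ with $y_\alpha=\int_{\mathbb{R}^n} x^\alpha\,d\mu(x)$ for all $\alpha\in\mathbb{Z}_+^n$ with $|\alpha|\le2$. A measure is $r$-atomic if it is of the form $\sum_{i=1}^r\lambda_i\delta_{u_i}$, where $\lambda_i>0$ and $\delta_{u_i}$ is the unit-mass measure supported at $u_i\in\mathbb{R}^n$.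
   Formalization: Added assumption: if y_0 = 0 then y_α = 0 for all |α| ≤ 2. Without it the claim fails: for n = 1, y = (0,0,1), M_1(y) = diag(0,1) is positive semidefinite but total mass 0 forces y_2 = 0. The condition is necessary for any representing measure. *)

theory Defs
  imports "HOL-Analysis.Analysis" "HOL-Probability.Giry_Monad"
begin

definition mdeg :: "nat ^ 'n::finite \<Rightarrow> nat" where
  "mdeg \<alpha> = (\<Sum>i\<in>UNIV. \<alpha> $ i)"

definition monomial :: "nat ^ 'n::finite \<Rightarrow> real ^ 'n \<Rightarrow> real" where
  "monomial \<alpha> x = (\<Prod>i\<in>UNIV. (x $ i) ^ (\<alpha> $ i))"

text \<open>
  Multi-indices of degree at most 1 as a type of their own, so that they can index the rows and
  columns of a library matrix.
\<close>

typedef 'n mindex1 = "{\<alpha> :: nat ^ 'n::finite. mdeg \<alpha> \<le> 1}"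
  morphisms mindex_of Mindex1
proof
  show "0 \<in> {\<alpha> :: nat ^ 'n. mdeg \<alpha> \<le> 1}"
    by (simp add: mdeg_def)
qed

instance mindex1 :: (finite) finite
proof
  have "finite {\<alpha> :: nat ^ 'a. mdeg \<alpha> \<le> 1}"
  proof (rule finite_subset)
    show "{\<alpha> :: nat ^ 'a. mdeg \<alpha> \<le> 1} \<subseteq> vec_lambda ` (PiE UNIV (\<lambda>_. {..1}))"
    proof
      fix \<alpha> :: "nat ^ 'a"
      assume "\<alpha> \<in> {\<alpha>. mdeg \<alpha> \<le> 1}"
      moreover have "\<alpha> $ i \<le> mdeg \<alpha>" for i
        unfolding mdeg_def by (rule member_le_sum) auto
      ultimately have "($) \<alpha> \<in> PiE UNIV (\<lambda>_. {..1})"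
        by (auto intro: order_trans)
      then show "\<alpha> \<in> vec_lambda ` (PiE UNIV (\<lambda>_. {..1}))"
        by (metis image_eqI vec_nth_inverse)
    qed
    show "finite (vec_lambda ` (PiE (UNIV :: 'a set) (\<lambda>_. {..1 :: nat})))"
      by (intro finite_imageI finite_PiE) auto
  qed
  then show "finite (UNIV :: 'a mindex1 set)"
    by (metis finite_imageI type_definition.Abs_image type_definition_mindex1)
qed

text \<open>
  A multisequence is a total function on multi-indices. Only its values at indices of degree at
  most 2 enter the definitions below.
\<close>

definition moment_matrix1 :: "(nat ^ 'n::finite \<Rightarrow> real) \<Rightarrow> real ^ 'n mindex1 ^ 'n mindex1" where
  "moment_matrix1 y = (\<chi> \<alpha> \<beta>. y (mindex_of \<alpha> + mindex_of \<beta>))"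

definition psd_matrix :: "real ^ 'm ^ 'm::finite \<Rightarrow> bool" where
  "psd_matrix A \<longleftrightarrow> transpose A = A \<and> (\<forall>v. 0 \<le> v \<bullet> (A *v v))"

definition representing_measure2 ::
    "(nat ^ 'n::finite \<Rightarrow> real) \<Rightarrow> (real ^ 'n) measure \<Rightarrow> bool" where
  "representing_measure2 y \<mu> \<longleftrightarrow>
     sets \<mu> = sets borel \<and>
     (\<forall>\<alpha>. mdeg \<alpha> \<le> 2 \<longrightarrow>
        integrable \<mu> (monomial \<alpha>) \<and> y \<alpha> = (\<integral>x. monomial \<alpha> x \<partial>\<mu>))"

text \<open>
  The measure is the weighted sum of Dirac measures, stated setwise since type \<^typ>\<open>'a measure\<close>
  carries no addition. The points are distinct, so that there are exactly \<open>r\<close> atoms.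
\<close>

definition atomic_measure :: "nat \<Rightarrow> (real ^ 'n::finite) measure \<Rightarrow> bool" where
  "atomic_measure r \<mu> \<longleftrightarrow>
     sets \<mu> = sets borel \<and>
     (\<exists>(w :: nat \<Rightarrow> real) u. (\<forall>i<r. 0 < w i) \<and> inj_on u {..<r} \<and>
        (\<forall>A\<in>sets borel. emeasure \<mu> A = (\<Sum>i<r. ennreal (w i) * emeasure (return borel (u i)) A)))"

text \<open>
  Positive semidefiniteness of \<^term>\<open>moment_matrix1 y\<close> does not by itself give a representing measure
  in the degenerate case \<^prop>\<open>y 0 = 0\<close>. For \<open>n = 1\<close> and \<open>y = (0, 0, 1)\<close> the matrix is \<open>diag(0, 1)\<close>,
  but a measure of total mass 0 cannot have second moment 1. The usual standing assumption is
  \<^prop>\<open>y 0 > 0\<close>. The weaker condition that \<^prop>\<open>y 0 = 0\<close> only for the zero multisequence is necessary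
  for a representing measure to exist, so it excludes nothing but counterexamples.
\<close>

end

theory Submission
  imports Defs
begin

text \<open>
  Write \<open>M\<close> for the moment matrix and \<open>e\<close> for the unit vector of the multi-index 0.  An atom \<open>u\<close> with
  weight \<open>w\<close> contributes to \<open>M\<close> the rank one matrix \<open>s s\<^sup>T\<close>, where \<open>s\<close> is \<open>sqrt w\<close> times the vector
  of all monomials of degree at most 1 at \<open>u\<close>.  Conversely these monomials are \<open>1, u\<^sub>1, \<dots>, u\<^sub>n\<close>, of
  which all but the first take arbitrary values, so every vector \<open>s\<close> with \<open>s \<bullet> e \<noteq> 0\<close> arises in this way, with
  \<open>w = (s \<bullet> e)\<^sup>2\<close>.  A representing measure with \<open>r\<close> atoms is therefore the same as a decomposition of
  \<open>M\<close> into \<open>r\<close> rank one terms \<open>s s\<^sup>T\<close> with \<open>s \<bullet> e \<noteq> 0\<close>, no two of the \<open>s\<close> being parallel.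

  A spectral decomposition may well use vectors orthogonal to \<open>e\<close>.  Instead, rank one terms are split
  off one at a time (lemma \<open>psd_rank_one_decomposition\<close>).  For \<open>p\<close> with \<open>p \<bullet> M p > 0\<close>, subtracting
  \<open>(M p) (M p)\<^sup>T / (p \<bullet> M p)\<close> leaves a positive semidefinite matrix that kills \<open>p\<close> and so has smaller
  rank.  With respect to the semi-inner product given by \<open>M\<close>, the choice \<open>p = e + z\<close>, where \<open>z\<close> has
  positive length and is orthogonal to \<open>e\<close>, makes the angle between \<open>p\<close> and \<open>e\<close> neither right nor zero.
  Not being right means that the term split off has a nonzero \<open>e\<close>-component; not being zero means
  that the remaining matrix still gives \<open>e\<close> positive length, so that the process can continue.  If
  no such \<open>z\<close> exists, \<open>M\<close> has rank one and is itself a single term.  The vectors produced are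
  linearly independent, which makes their number equal to the rank and the atoms distinct.

  All this assumes \<open>y 0 = e \<bullet> M e > 0\<close>.  If \<open>y 0 = 0\<close>, the second hypothesis gives \<open>M = 0\<close>, the
  decomposition is empty and the measure is zero.
\<close>

section \<open>Positive semidefinite operators as sums of rank one operators\<close>

definition psd_operator :: "('a::euclidean_space \<Rightarrow> 'a) \<Rightarrow> bool" where
  "psd_operator f \<longleftrightarrow> linear f \<and> (\<forall>x y. x \<bullet> f y = f x \<bullet> y) \<and> (\<forall>x. 0 \<le> x \<bullet> f x)"

lemma psd_operatorD:
  assumes "psd_operator f"
  shows "linear f" "x \<bullet> f y = f x \<bullet> y" "0 \<le> x \<bullet> f x"
  using assms by (auto simp: psd_operator_def)

lemma psd_operator_matrix:
  assumes "psd_matrix A"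
  shows "psd_operator ((*v) A)"
  unfolding psd_operator_def
proof (intro conjI allI)
  fix x y
  show "x \<bullet> (A *v y) = (A *v x) \<bullet> y"
    using assms dot_lmul_matrix[of x A y] transpose_matrix_vector[of A x]
    by (simp add: psd_matrix_def)
qed (use assms in \<open>auto simp: psd_matrix_def\<close>)

lemma psd_operator_isotropic_imp_kernel:
  assumes f: "psd_operator f" and z: "z \<bullet> f z = 0"
  shows "f z = 0"
proof (rule ccontr)
  interpret linear f by (rule psd_operatorD(1)[OF f])
  assume "f z \<noteq> 0"
  define a where "a = f z \<bullet> f z"
  define b where "b = f z \<bullet> f (f z)"
  have a: "a > 0" using \<open>f z \<noteq> 0\<close> by (simp add: a_def)
  have b: "b \<ge> 0" unfolding b_def by (rule psd_operatorD(3)[OF f])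
  \<comment> \<open>Along the line \<open>z + t f z\<close> the quadratic form is \<open>2 a t + b t\<^sup>2\<close>, negative if \<open>t < 0\<close> and \<open>b \<bar>t\<bar> < 2 a\<close>.\<close>
  define t where "t = - a / (b + 1)"
  have "0 \<le> (z + t *\<^sub>R f z) \<bullet> f (z + t *\<^sub>R f z)" by (rule psd_operatorD(3)[OF f])
  also have "\<dots> = 2 * t * a + t^2 * b"
    using z psd_operatorD(2)[OF f, of z "f z"]
    by (simp add: add scale inner_add_left inner_add_right a_def b_def power2_eq_square
        distrib_left mult.assoc)
  also have "\<dots> = t * a * (2 - b / (b + 1))"
    by (simp add: t_def power2_eq_square algebra_simps)
  also have "\<dots> < 0"
  proof -
    have "b / (b + 1) < 2" using b by (simp add: divide_simps)
    moreover have "t < 0" using a b by (simp add: t_def divide_neg_pos)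
    ultimately show ?thesis using a by (simp add: mult_neg_pos)
  qed
  finally show False by simp
qed

text \<open>
  One step of rank reduction: \<open>deflate f p\<close> is \<open>f\<close> restricted, as a quadratic form, to the
  \<open>f\<close>-orthogonal complement of \<open>p\<close> and extended by zero along \<open>p\<close>.
\<close>

definition deflate :: "('a::euclidean_space \<Rightarrow> 'a) \<Rightarrow> 'a \<Rightarrow> 'a \<Rightarrow> 'a" where
  "deflate f p x = f x - ((f p \<bullet> x) / (p \<bullet> f p)) *\<^sub>R f p"

lemma deflate_eq_image:
  assumes "linear f"
  shows "deflate f p x = f (x - ((f p \<bullet> x) / (p \<bullet> f p)) *\<^sub>R p)"
proof -
  interpret linear f by fact
  show ?thesis by (simp add: deflate_def diff scale)
qed

lemma psd_operator_deflate:
  assumes f: "psd_operator f" and p: "p \<bullet> f p > 0"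
  shows "psd_operator (deflate f p)"
  unfolding psd_operator_def
proof (intro conjI allI)
  interpret linear f by (rule psd_operatorD(1)[OF f])
  show "linear (deflate f p)"
    by (rule linearI)
      (simp_all add: deflate_def add scale inner_add_right add_divide_distrib algebra_simps)
  fix x y
  show "x \<bullet> deflate f p y = deflate f p x \<bullet> y"
    using psd_operatorD(2)[OF f, of x y]
    by (simp add: deflate_def inner_diff_left inner_diff_right inner_commute[of _ "f p"])
  define c where "c = (f p \<bullet> x) / (p \<bullet> f p)"
  have c: "c * (p \<bullet> f p) = f p \<bullet> x" using p by (simp add: c_def)
  \<comment> \<open>The form of the deflated operator at \<open>x\<close> is that of \<open>f\<close> at the projection of \<open>x\<close>.\<close>
  have "0 \<le> (x - c *\<^sub>R p) \<bullet> f (x - c *\<^sub>R p)" by (rule psd_operatorD(3)[OF f])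
  also have "\<dots> = x \<bullet> f x - c * (x \<bullet> f p) - c * (p \<bullet> f x) + c * (c * (p \<bullet> f p))"
    by (simp add: diff scale inner_diff_left inner_diff_right algebra_simps)
  also have "\<dots> = x \<bullet> f x - c * (f p \<bullet> x)"
    unfolding c using psd_operatorD(2)[OF f, of p x] by (simp add: inner_commute[of x "f p"])
  also have "\<dots> = x \<bullet> deflate f p x"
    by (simp add: deflate_def c_def inner_diff_right inner_commute[of x "f p"])
  finally show "0 \<le> x \<bullet> deflate f p x" .
qed

lemma range_deflate_psubset:
  assumes f: "psd_operator f" and p: "p \<bullet> f p > 0"
  shows "range (deflate f p) \<subset> range f"
proof
  show "range (deflate f p) \<subseteq> range f"
    using deflate_eq_image[OF psd_operatorD(1)[OF f]] by auto
  have "p \<bullet> deflate f p x = 0" for x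
    using p psd_operatorD(2)[OF f, of p x]
    by (simp add: deflate_def inner_diff_right)
  then have "f p \<notin> range (deflate f p)" using p by force
  then show "range (deflate f p) \<noteq> range f" by auto
qed

text \<open>
  The vectors are required to lie in the range of \<open>f\<close> so that, being independent, they form a basis
  of it.
\<close>

lemma psd_rank_one_decomposition:
  fixes f :: "'a::euclidean_space \<Rightarrow> 'a"
  assumes "psd_operator f" and "e \<bullet> f e > 0"
  shows "\<exists>S. finite S \<and> independent S \<and> S \<subseteq> range f \<and> (\<forall>s\<in>S. s \<bullet> e \<noteq> 0) \<and>
    (\<forall>x. f x = (\<Sum>s\<in>S. (s \<bullet> x) *\<^sub>R s))"
  using assms
proof (induction "dim (range f)" arbitrary: f rule: less_induct)
  case less
  note f = less.prems(1) and e = less.prems(2)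
  interpret linear f by (rule psd_operatorD(1)[OF f])
  define proj where "proj w = w - ((f e \<bullet> w) / (e \<bullet> f e)) *\<^sub>R e" for w
  have f_proj: "f (proj w) = deflate f e w" for w
    unfolding proj_def deflate_eq_image[OF psd_operatorD(1)[OF f]] ..
  show ?case
  proof (cases "\<forall>w. proj w \<bullet> f (proj w) = 0")
    case True
    define s where "s = (1 / sqrt (e \<bullet> f e)) *\<^sub>R f e"
    have sq: "sqrt (e \<bullet> f e) * sqrt (e \<bullet> f e) = e \<bullet> f e" using e by simp
    have "deflate f e x = 0" for x
      using psd_operator_isotropic_imp_kernel[OF f] True f_proj by metis
    then have "f x = ((f e \<bullet> x) / (e \<bullet> f e)) *\<^sub>R f e" for x
      unfolding deflate_def by (metis eq_iff_diff_eq_0)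
    moreover have "(s \<bullet> x) *\<^sub>R s = ((f e \<bullet> x) / (e \<bullet> f e)) *\<^sub>R f e" for x
      using sq by (simp add: s_def)
    ultimately have "f x = (s \<bullet> x) *\<^sub>R s" for x
      by metis
    moreover have "s \<bullet> e \<noteq> 0"
      using e by (simp add: s_def inner_commute[of "f e"])
    moreover have "s \<in> range f"
      unfolding s_def by (metis scale rangeI)
    moreover have "independent {s}" using \<open>s \<bullet> e \<noteq> 0\<close> by (auto simp: dependent_single)
    ultimately show ?thesis by (intro exI[of _ "{s}"]) auto
  next
    case False
    then obtain w where w: "proj w \<bullet> f (proj w) \<noteq> 0" by blast
    define z where "z = proj w"
    define p where "p = e + z"
    have z_pos: "z \<bullet> f z > 0"
      using w psd_operatorD(3)[OF f, of z] by (simp add: z_def)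
    have ez: "e \<bullet> f z = 0"
      using e psd_operatorD(2)[OF f, of e w]
      by (simp add: z_def f_proj deflate_def inner_diff_right)
    have ze: "z \<bullet> f e = 0"
      using ez psd_operatorD(2)[OF f, of e z] by (simp add: inner_commute)
    have pp: "p \<bullet> f p = e \<bullet> f e + z \<bullet> f z"
      using ez ze by (simp add: p_def add inner_add_left inner_add_right)
    have p_pos: "p \<bullet> f p > 0" using pp e z_pos by simp
    have fpe: "f p \<bullet> e = e \<bullet> f e"
      using ez by (simp add: p_def add inner_commute[of _ e] inner_add_right)
    define g where "g = deflate f p"
    have g: "psd_operator g" unfolding g_def by (rule psd_operator_deflate[OF f p_pos])
    have g_range: "range g \<subset> range f"
      unfolding g_def by (rule range_deflate_psubset[OF f p_pos])
    have "subspace (range h)" if "psd_operator h" for h :: "'a \<Rightarrow> 'a"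
      using linear_subspace_image[OF psd_operatorD(1)[OF that] subspace_UNIV] .
    then have "dim (range g) < dim (range f)"
      using g_range f g by (intro dim_psubset) (metis span_eq_iff)
    moreover have "e \<bullet> g e > 0"
    proof -
      have "e \<bullet> g e = (e \<bullet> f e) * (z \<bullet> f z) / (p \<bullet> f p)"
        using p_pos fpe pp
        by (simp add: g_def deflate_def inner_diff_right inner_commute[of e "f p"] field_simps)
      then show ?thesis using e z_pos p_pos by simp
    qed
    ultimately obtain T where T: "finite T" "independent T" "T \<subseteq> range g"
      "\<forall>s\<in>T. s \<bullet> e \<noteq> 0" "\<And>x. g x = (\<Sum>s\<in>T. (s \<bullet> x) *\<^sub>R s)"
      using less.hyps[OF _ g] by blast
    define s where "s = (1 / sqrt (p \<bullet> f p)) *\<^sub>R f p"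
    have sq: "sqrt (p \<bullet> f p) * sqrt (p \<bullet> f p) = p \<bullet> f p" using p_pos by simp
    \<comment> \<open>The new vector is independent of the old ones because they are orthogonal to \<open>p\<close>.\<close>
    have "p \<bullet> t = 0" if "t \<in> T" for t
    proof -
      have "p \<bullet> g x = 0" for x
        using p_pos psd_operatorD(2)[OF f, of p x]
        by (simp add: g_def deflate_def inner_diff_right)
      then show ?thesis using T(3) that by auto
    qed
    then have "p \<bullet> t = 0" if "t \<in> span T" for t
      using that orthogonal_to_span[of t T p] by (auto simp: orthogonal_def)
    moreover have "p \<bullet> s \<noteq> 0" using p_pos by (simp add: s_def)
    ultimately have s_span: "s \<notin> span T" by blast
    then have sT: "s \<notin> T" using span_base by blast
    have "f x = (\<Sum>t\<in>insert s T. (t \<bullet> x) *\<^sub>R t)" for x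
    proof -
      have "f x = (s \<bullet> x) *\<^sub>R s + g x"
        using sq by (simp add: g_def deflate_def s_def)
      then show ?thesis unfolding T(5) using T(1) sT by simp
    qed
    moreover have "s \<bullet> e \<noteq> 0" using e fpe p_pos by (simp add: s_def)
    moreover have "s \<in> range f" unfolding s_def by (metis scale rangeI)
    moreover have "independent (insert s T)"
      using T(2) s_span by (simp add: independent_insert)
    ultimately show ?thesis
      using T g_range by (intro exI[of _ "insert s T"]) auto
  qed
qed

section \<open>Multi-indices and monomials of low degree\<close>

lemma mdeg_add: "mdeg (\<alpha> + \<beta>) = mdeg \<alpha> + mdeg \<beta>"
  by (simp add: mdeg_def sum.distrib)

lemma mdeg_axis: "mdeg (axis i k) = k"
  by (simp add: mdeg_def axis_def)

lemma monomial_zero: "monomial 0 x = 1"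
  by (simp add: monomial_def)

lemma monomial_add: "monomial (\<alpha> + \<beta>) x = monomial \<alpha> x * monomial \<beta> x"
  by (simp add: monomial_def power_add prod.distrib)

lemma monomial_axis: "monomial (axis i 1) x = x $ i"
proof -
  have "monomial (axis i 1) x = (\<Prod>j\<in>UNIV. if j = i then x $ i else 1)"
    unfolding monomial_def by (intro prod.cong) (auto simp: axis_def)
  then show ?thesis by simp
qed

lemma borel_measurable_monomial: "monomial \<alpha> \<in> borel_measurable borel"
  unfolding monomial_def[abs_def] by measurable

lemma multiindex_split_unit:
  assumes "\<alpha> \<noteq> (0 :: nat ^ 'n::finite)"
  obtains i \<beta> where "\<alpha> = axis i 1 + \<beta>" "mdeg \<alpha> = Suc (mdeg \<beta>)"
proof -
  from assms obtain i where i: "\<alpha> $ i \<noteq> 0" by (auto simp: vec_eq_iff)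
  define \<beta> where "\<beta> = \<alpha> - axis i 1"
  have "\<alpha> = axis i 1 + \<beta>" using i by (auto simp: vec_eq_iff \<beta>_def axis_def)
  moreover from this have "mdeg \<alpha> = Suc (mdeg \<beta>)" by (metis mdeg_add mdeg_axis plus_1_eq_Suc)
  ultimately show thesis by (rule that)
qed

lemma mdeg_eq_0: "mdeg \<alpha> = 0 \<longleftrightarrow> \<alpha> = 0"
  by (auto simp: mdeg_def vec_eq_iff)

lemma mdeg_le_1_cases:
  assumes "mdeg \<alpha> \<le> 1"
  obtains "\<alpha> = 0" | i where "\<alpha> = axis i 1"
proof (cases "\<alpha> = 0")
  case False
  then obtain i \<beta> where "\<alpha> = axis i 1 + \<beta>" "mdeg \<alpha> = Suc (mdeg \<beta>)" by (rule multiindex_split_unit)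
  then have "\<alpha> = axis i 1" using assms mdeg_eq_0[of \<beta>] by simp
  then show thesis by (rule that(2))
qed (rule that(1))

lemma mdeg_le_2_split:
  assumes "mdeg \<alpha> \<le> 2"
  obtains \<beta> \<gamma> where "\<alpha> = \<beta> + \<gamma>" "mdeg \<beta> \<le> 1" "mdeg \<gamma> \<le> 1"
proof (cases "\<alpha> = 0")
  case True
  then show thesis using that[of 0 0] by (simp add: mdeg_def)
next
  case False
  then obtain i \<beta> where "\<alpha> = axis i 1 + \<beta>" "mdeg \<alpha> = Suc (mdeg \<beta>)" by (rule multiindex_split_unit)
  then show thesis using assms that[of "axis i 1" \<beta>] by (simp add: mdeg_axis)
qed

section \<open>From rank one terms to atoms\<close>

lemma moment_matrix1_nth:
  assumes "mdeg \<alpha> \<le> 1" "mdeg \<beta> \<le> 1"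
  shows "moment_matrix1 y $ Mindex1 \<alpha> $ Mindex1 \<beta> = y (\<alpha> + \<beta>)"
  using assms by (simp add: moment_matrix1_def Mindex1_inverse)

text \<open>The atom of a vector is obtained by dehomogenization, as in passing from projective to affine space.\<close>

definition atom_of :: "real ^ 'n::finite mindex1 \<Rightarrow> real ^ 'n" where
  "atom_of s = (\<chi> i. s $ Mindex1 (axis i 1) / s $ Mindex1 0)"

lemma nth_eq_monomial_atom_of:
  assumes "s $ Mindex1 0 \<noteq> 0" "mdeg \<alpha> \<le> 1"
  shows "s $ Mindex1 \<alpha> = s $ Mindex1 0 * monomial \<alpha> (atom_of s)"
  using assms(2)
proof (cases rule: mdeg_le_1_cases)
  case 1
  then show ?thesis by (simp add: monomial_zero)
next
  case (2 i)
  then show ?thesis using assms(1) unfolding \<open>\<alpha> = axis i 1\<close> monomial_axis by (simp add: atom_of_def)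
qed

text \<open>Vectors with the same atom are parallel.\<close>

lemma inj_on_atom_of:
  assumes "independent S" and nz: "\<forall>s\<in>S. s $ Mindex1 0 \<noteq> 0"
  shows "inj_on atom_of S"
proof (rule inj_onI, rule ccontr)
  fix s t assume st: "s \<in> S" "t \<in> S" "atom_of s = atom_of t" "s \<noteq> t"
  define c where "c = s $ Mindex1 0 / t $ Mindex1 0"
  have c: "s $ Mindex1 0 = c * t $ Mindex1 0" using nz st by (simp add: c_def)
  have "s $ a = c * t $ a" for a
  proof -
    have a: "Mindex1 (mindex_of a) = a" "mdeg (mindex_of a) \<le> 1"
      using mindex_of_inverse mindex_of by auto
    have eq: "r $ a = r $ Mindex1 0 * monomial (mindex_of a) (atom_of r)" if "r \<in> S" for r
      using nth_eq_monomial_atom_of[OF _ a(2), of r] nz that unfolding a(1) by blast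
    have "s $ a = c * t $ Mindex1 0 * monomial (mindex_of a) (atom_of t)"
      unfolding c[symmetric] st(3)[symmetric] by (rule eq[OF st(1)])
    also have "\<dots> = c * t $ a"
      unfolding mult.assoc eq[OF st(2), symmetric] ..
    finally show ?thesis .
  qed
  then have "s = c *\<^sub>R t" unfolding vec_eq_iff vector_scaleR_component real_scaleR_def by blast
  moreover have "t \<in> S - {s}" using st by auto
  ultimately have "s \<in> span (S - {s})" by (metis span_base span_scale)
  then show False using assms(1) st(1) by (auto simp: dependent_def)
qed

lemma ex_atomic_measure:
  fixes u :: "nat \<Rightarrow> real ^ 'n::finite"
  assumes w: "\<And>i. i < r \<Longrightarrow> 0 < w i" and u: "inj_on u {..<r}"
    and y: "\<And>\<alpha>. mdeg \<alpha> \<le> 2 \<Longrightarrow> y \<alpha> = (\<Sum>i<r. w i * monomial \<alpha> (u i))"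
  shows "\<exists>\<mu>. representing_measure2 y \<mu> \<and> atomic_measure r \<mu>"
proof -
  define \<nu> where "\<nu> = point_measure {..<r} (\<lambda>i. ennreal (w i))"
  define \<mu> where "\<mu> = distr \<nu> borel u"
  have u_meas: "u \<in> measurable \<nu> borel"
    by (simp add: \<nu>_def)
  have "integrable \<mu> (monomial \<alpha>) \<and> y \<alpha> = (\<integral>x. monomial \<alpha> x \<partial>\<mu>)" if "mdeg \<alpha> \<le> 2" for \<alpha>
  proof
    show "integrable \<mu> (monomial \<alpha>)"
      unfolding \<mu>_def integrable_distr_eq[OF u_meas borel_measurable_monomial]
      unfolding \<nu>_def by (simp add: integrable_point_measure_finite)
    show "y \<alpha> = (\<integral>x. monomial \<alpha> x \<partial>\<mu>)"
      unfolding \<mu>_def integral_distr[OF u_meas borel_measurable_monomial]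
      unfolding \<nu>_def using w y[OF that]
      by (subst lebesgue_integral_point_measure_finite) (auto simp: less_imp_le)
  qed
  then have "representing_measure2 y \<mu>"
    by (simp add: representing_measure2_def \<mu>_def)
  moreover have "emeasure \<mu> A = (\<Sum>i<r. ennreal (w i) * emeasure (return borel (u i)) A)"
    if "A \<in> sets borel" for A
  proof -
    have "emeasure \<mu> A = emeasure \<nu> (u -` A \<inter> {..<r})"
      unfolding \<mu>_def emeasure_distr[OF u_meas that] by (simp add: \<nu>_def space_point_measure)
    also have "\<dots> = (\<Sum>i\<in>u -` A \<inter> {..<r}. ennreal (w i))"
      unfolding \<nu>_def by (rule emeasure_point_measure_finite) auto
    also have "\<dots> = (\<Sum>i<r. ennreal (w i) * indicator A (u i))"
      by (rule sum.mono_neutral_cong_left) (auto simp: indicator_def)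
    finally show ?thesis using that by simp
  qed
  then have "atomic_measure r \<mu>"
    using w u by (auto simp: atomic_measure_def \<mu>_def)
  ultimately show ?thesis by blast
qed

theorem theorem4p5:
  fixes y :: "nat ^ 'n::finite \<Rightarrow> real"
  assumes "psd_matrix (moment_matrix1 y)"
    and "y 0 = 0 \<longrightarrow> (\<forall>\<alpha>. mdeg \<alpha> \<le> 2 \<longrightarrow> y \<alpha> = 0)"
  shows "\<exists>\<mu>. representing_measure2 y \<mu> \<and> atomic_measure (rank (moment_matrix1 y)) \<mu>"
proof -
  define M where "M = moment_matrix1 y"
  define e :: "real ^ 'n mindex1" where "e = axis (Mindex1 0) 1"
  have deg0: "mdeg (0 :: nat ^ 'n) \<le> 1" by (simp add: mdeg_def)
  have inner_e: "s \<bullet> e = s $ Mindex1 0" for s by (simp add: e_def inner_axis)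
  have f: "psd_operator ((*v) M)" using psd_operator_matrix assms(1) by (simp add: M_def)
  have mult_axis: "(M *v axis b 1) $ a = M $ a $ b" for a b
    by (simp add: matrix_vector_mul_component inner_axis)
  have eMe: "e \<bullet> (M *v e) = y 0"
    using moment_matrix1_nth[OF deg0 deg0, of y] mult_axis
    by (simp add: inner_commute[of e] inner_e) (simp add: e_def M_def mult_axis)
  have "\<exists>S. finite S \<and> independent S \<and> S \<subseteq> range ((*v) M) \<and> (\<forall>s\<in>S. s \<bullet> e \<noteq> 0) \<and>
    (\<forall>x. M *v x = (\<Sum>s\<in>S. (s \<bullet> x) *\<^sub>R s))"
  proof (cases "y 0 = 0")
    case True
    have "M $ a $ b = 0" for a b
      using assms(2) True mindex_of[of a] mindex_of[of b]
      by (auto simp: M_def moment_matrix1_def mdeg_add)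
    then have "M = 0" by (simp add: vec_eq_iff)
    then show ?thesis by (intro exI[of _ "{}"]) (simp add: independent_empty)
  next
    case False
    then have "e \<bullet> (M *v e) > 0" using psd_operatorD(3)[OF f, of e] eMe by simp
    then show ?thesis by (rule psd_rank_one_decomposition[OF f])
  qed
  then obtain S where S: "finite S" "independent S" "S \<subseteq> range ((*v) M)"
    "\<forall>s\<in>S. s $ Mindex1 0 \<noteq> 0" "\<And>x. M *v x = (\<Sum>s\<in>S. (s \<bullet> x) *\<^sub>R s)"
    unfolding inner_e by blast
  have "range ((*v) M) \<subseteq> span S"
    unfolding S(5) by (blast intro: span_sum span_scale span_base)
  then have card_S: "card S = rank M"
    using basis_card_eq_dim[OF S(3) _ S(2)] by (simp add: rank_dim_range)
  have y_eq: "y \<alpha> = (\<Sum>s\<in>S. (s $ Mindex1 0)\<^sup>2 * monomial \<alpha> (atom_of s))"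
    if \<alpha>: "mdeg \<alpha> \<le> 2" for \<alpha>
  proof -
    obtain \<beta> \<gamma> where \<beta>\<gamma>: "\<alpha> = \<beta> + \<gamma>" "mdeg \<beta> \<le> 1" "mdeg \<gamma> \<le> 1"
      using \<alpha> by (rule mdeg_le_2_split)
    have "y \<alpha> = (M *v axis (Mindex1 \<gamma>) 1) $ Mindex1 \<beta>"
      using \<beta>\<gamma> moment_matrix1_nth[OF \<beta>\<gamma>(2,3)] unfolding mult_axis by (simp add: M_def)
    also have "\<dots> = (\<Sum>s\<in>S. s $ Mindex1 \<gamma> * s $ Mindex1 \<beta>)"
      by (simp add: S(5) inner_axis sum_component)
    also have "\<dots> = (\<Sum>s\<in>S. (s $ Mindex1 0)\<^sup>2 * monomial \<alpha> (atom_of s))"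
    proof (rule sum.cong[OF refl])
      fix s assume "s \<in> S"
      then have nz: "s $ Mindex1 0 \<noteq> 0" using S(4) by blast
      show "s $ Mindex1 \<gamma> * s $ Mindex1 \<beta> = (s $ Mindex1 0)\<^sup>2 * monomial \<alpha> (atom_of s)"
        unfolding nth_eq_monomial_atom_of[OF nz \<beta>\<gamma>(2)] nth_eq_monomial_atom_of[OF nz \<beta>\<gamma>(3)]
        by (simp add: \<beta>\<gamma>(1) monomial_add power2_eq_square)
    qed
    finally show ?thesis .
  qed
  obtain v where v: "bij_betw v {..<card S} S"
    using ex_bij_betw_nat_finite[OF S(1)] by (auto simp: atLeast0LessThan)
  have "\<exists>\<mu>. representing_measure2 y \<mu> \<and> atomic_measure (card S) \<mu>"
  proof (rule ex_atomic_measure[where w = "\<lambda>i. (v i $ Mindex1 0)\<^sup>2" and u = "atom_of \<circ> v"])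
    show "0 < (v i $ Mindex1 0)\<^sup>2" if "i < card S" for i
      using S(4) bij_betw_apply[OF v] that by simp
    show "inj_on (atom_of \<circ> v) {..<card S}"
      using v inj_on_atom_of[OF S(2,4)] by (auto simp: bij_betw_def intro: comp_inj_on)
    show "y \<alpha> = (\<Sum>i<card S. (v i $ Mindex1 0)\<^sup>2 * monomial \<alpha> ((atom_of \<circ> v) i))"
      if "mdeg \<alpha> \<le> 2" for \<alpha>
      unfolding y_eq[OF that] by (simp add: sum.reindex_bij_betw[OF v, symmetric])
  qed
  then show ?thesis by (simp add: card_S M_def)
qed

end
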